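(* Let $N\ge 2$, $0<\rho<\frac{\pi}{2N}$, and let $H_N\in\mathbb R^{N\times N}$ be the normalized weighted histopolation matrix for the Chebyshev weight of the first kind on the cells $s_i=[\cos(\tau_i+\rho),\cos(\tau_i-\rho)]$, $\tau_i=\frac{(2i-1)\pi}{2N}$, $i=1,\ldots,N$. Put $a_k=\frac{(1/2)_k}{k!}$. Then the singular values of $H_N$, up to ordering, are $$\sigma_0=\sqrt N,\qquad \sigma_k=\sqrt{\tfrac N2}\,a_k\frac{\sin(k\rho)}{k\rho},\quad k=1,\ldots,N-1,$$ with $$\sigma_{\max}(H_N)=\sqrt N,\qquad \sigma_{\min}(H_N)=\sqrt{\tfrac N2}\,a_{N-1}\frac{\sin((N-1)\rho)}{(N-1)\rho},$$ so that $$\kappa_2(H_N)=\frac{\sqrt2}{a_{N-1}}\frac{(N-1)\rho}{\sin((N-1)\rho)}.$$ Moreover, the map $\rho\mapsto\kappa_2(H_N)$ is strictly increasing on $(0,\pi/(2N))$, and $$\inf_{0<\rho<\frac{\pi}{2N}}\kappa_2(H_N)=\lim_{\rho\to0^+}\kappa_2(H_N)=\frac{\sqrt2}{a_{N-1}}.$$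
   Context: $(s)_k$ is the Pochhammer symbol (rising factorial). The weight is $\omega(x)=\frac{1}{\sqrt{1-x^2}}$ on $(-1,1)$. $P_k^{(-1/2,-1/2)}$ is the classical Jacobi polynomial, i.e. $P_k^{(-1/2,-1/2)}(\cos\theta)=a_k\cos(k\theta)$. With $m_i=\int_{s_i}\omega(x)\,dx$, the matrix $H_N$ (which depends on $\rho$) is defined by $[H_N]_{i,k+1}=\frac1{m_i}\int_{s_i}P_k^{(-1/2,-1/2)}(x)\,\omega(x)\,dx$, $i=1,\ldots,N$, $k=0,\ldots,N-1$. $\kappa_2=\sigma_{\max}/\sigma_{\min}$ is the spectral condition number. *)

theory Defs
  imports "HOL-Analysis.Analysis" "Jordan_Normal_Form.Char_Poly"
begin

(* Szego, Orthogonal Polynomials, (4.3.2); standard normalisation, value (n + \<alpha> gchoose n) at 1 *)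
definition jacobi_P :: "real \<Rightarrow> real \<Rightarrow> nat \<Rightarrow> real \<Rightarrow> real" where
  "jacobi_P \<alpha> \<beta> n x =
     (\<Sum>s\<le>n. ((real n + \<alpha>) gchoose (n - s)) * ((real n + \<beta>) gchoose s) *
        ((x - 1) / 2) ^ s * ((x + 1) / 2) ^ (n - s))"

(* only meaningful on -1 < x < 1 *)
definition cheb_weight :: "real \<Rightarrow> real" where
  "cheb_weight x = 1 / sqrt (1 - x\<^sup>2)"

definition cheb_node :: "nat \<Rightarrow> nat \<Rightarrow> real" where
  "cheb_node N i = (2 * real i - 1) * pi / (2 * real N)"

definition cheb_cell :: "nat \<Rightarrow> real \<Rightarrow> nat \<Rightarrow> real set" where
  "cheb_cell N \<rho> i = {cos (cheb_node N i + \<rho>)..cos (cheb_node N i - \<rho>)}"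

(* Matrix indices start at 0 while cells are numbered from 1, so row i belongs to cell Suc i;
   column k belongs to the Jacobi polynomial of degree k. *)
definition hist_mat :: "nat \<Rightarrow> real \<Rightarrow> real mat" where
  "hist_mat N \<rho> = Matrix.mat N N (\<lambda>(i, k).
     integral (cheb_cell N \<rho> (Suc i)) (\<lambda>x. jacobi_P (- 1 / 2) (- 1 / 2) k x * cheb_weight x) /
     integral (cheb_cell N \<rho> (Suc i)) cheb_weight)"

(* Square roots of the eigenvalues of A^T A, with algebraic multiplicity. That matrix is symmetric
   positive semidefinite, so its characteristic polynomial splits over the reals with nonnegative
   roots, and an n x n matrix A has exactly n singular values. *)
definition singular_values :: "real mat \<Rightarrow> real multiset" where
  "singular_values A = image_mset sqrt (proots (char_poly (transpose_mat A * A)))"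

definition sigma_max :: "real mat \<Rightarrow> real" where
  "sigma_max A = Max (set_mset (singular_values A))"

definition sigma_min :: "real mat \<Rightarrow> real" where
  "sigma_min A = Min (set_mset (singular_values A))"

(* 0 instead of infinity when A is singular *)
definition cond2 :: "real mat \<Rightarrow> real" where
  "cond2 A = sigma_max A / sigma_min A"

definition cheb_coeff :: "nat \<Rightarrow> real" where
  "cheb_coeff k = pochhammer (1 / 2) k / fact k"

end

theory Submission
  imports Defs "HOL-Real_Asymp.Real_Asymp"
begin

text \<open>
  The substitution \<open>x = cos t\<close> turns everything into trigonometry. The Jacobi polynomial with both
  parameters \<open>-1/2\<close> becomes \<open>a\<^sub>k cos (k t)\<close> (lemma \<open>jacobi_P_cos\<close>), and the Chebyshev weight becomes
  \<open>dt\<close>, so that a cell is an interval of length \<open>2 \<rho>\<close> around its node. Averaging \<open>cos (k t)\<close> over an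
  interval of fixed length multiplies the value at the midpoint by the factor
  \<open>sin (k \<rho>) / (k \<rho>)\<close>, which does not depend on the interval. Hence the matrix is
  \<open>C D\<close> with \<open>C\<^sub>i\<^sub>k = cos (k \<tau>\<^sub>i)\<close> and \<open>D\<close> diagonal (lemma \<open>hist_mat_entry\<close>).

  The nodes are the zeros of the Chebyshev polynomial of degree \<open>N\<close> (in the variable \<open>t\<close>), where the
  cosines are orthogonal (lemma \<open>cos_node_orthogonal\<close>). The Gram matrix \<open>D C\<^sup>T C D\<close> is therefore
  diagonal, and the singular values are the diagonal entries of \<open>D\<close> times the column norms of \<open>C\<close>,
  which are \<open>\<surd>N\<close> for \<open>k = 0\<close> and \<open>\<surd>(N/2)\<close> otherwise.

  Both \<open>a\<^sub>k\<close> and \<open>sin x / x\<close> on \<open>(0, \<pi>)\<close> decrease, so the extreme singular values are the first and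
  the last one. Their quotient is a constant times \<open>x / sin x\<close> at \<open>x = (N - 1) \<rho>\<close>; strict
  monotonicity in \<open>\<rho>\<close> follows from that of \<open>sin x / x\<close>, and the infimum of an increasing function
  is its limit at the left end point.
\<close>

section \<open>The Chebyshev case of the Jacobi polynomials\<close>

lemma gbinomial_half_eq:
  assumes "s \<le> n"
  shows "((real n - 1/2) gchoose s) = pochhammer (1/2) n / (pochhammer (1/2) (n - s) * fact s)"
proof -
  have "pochhammer (1/2 :: real) n = pochhammer (1/2) (n - s) * pochhammer (1/2 + of_nat (n - s)) s"
    using pochhammer_product[of "n - s" n "1/2 :: real"] assms by simp
  moreover have "pochhammer (1/2 :: real) (n - s) \<noteq> 0"
    using pochhammer_pos[of "1/2 :: real" "n - s"] by simp
  moreover have "((real n - 1/2) gchoose s) = pochhammer (1/2 + of_nat (n - s)) s / fact s"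
    using assms by (simp add: gbinomial_pochhammer' of_nat_diff algebra_simps)
  ultimately show ?thesis by (simp add: field_simps)
qed

lemma fact_mult_pochhammer_half:
  "fact n * pochhammer (1/2) n = (fact (2 * n) / 4 ^ n :: real)"
proof -
  have "(2::real) ^ (2 * n) = 4 ^ n" by (simp add: power_mult)
  then show ?thesis using fact_double[of n, where 'a = real] by (simp add: field_simps)
qed

text \<open>Since \<open>n - 1/2\<close> choose \<open>s\<close> is a quotient of half-integer Pochhammer symbols, and each of these pairs
  with a factorial to the factorial of an even number, the product collapses to an even entry of
  row \<open>2 n\<close> of Pascal's triangle, up to a factor that depends on \<open>n\<close> only.\<close>
lemma gbinomial_half_mult:
  assumes "s \<le> n"
  shows "((real n - 1/2) gchoose (n - s)) * ((real n - 1/2) gchoose s) =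
           cheb_coeff n * real ((2 * n) choose (2 * s))"
proof -
  let ?p = "pochhammer (1/2 :: real)"
  have p: "?p m = fact (2 * m) / (4 ^ m * fact m)" for m
    using fact_mult_pochhammer_half[of m] by (simp add: field_simps)
  have e: "(4::real) ^ n = 4 ^ s * 4 ^ (n - s)"
    using assms by (simp flip: power_add)
  have "((real n - 1/2) gchoose (n - s)) * ((real n - 1/2) gchoose s) =
          ?p n * ?p n / ((fact s * ?p s) * (fact (n - s) * ?p (n - s)))"
    using assms gbinomial_half_eq[of s n] gbinomial_half_eq[of "n - s" n] by simp
  also have "\<dots> = ?p n * (?p n * 4 ^ n) / (fact (2 * s) * fact (2 * (n - s)))"
    by (simp add: fact_mult_pochhammer_half e)
  also have "?p n * 4 ^ n = fact (2 * n) / fact n" by (simp add: p)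
  also have "fact (2 * n) = real ((2 * n) choose (2 * s)) * (fact (2 * s) * fact (2 * (n - s)))"
    using assms by (simp add: binomial_fact diff_mult_distrib2)
  finally show ?thesis by (simp add: cheb_coeff_def)
qed

text \<open>The real part of De Moivre's formula for \<open>(cos t + i sin t)\<^bsup>2n\<^esup>\<close>: the odd powers of \<open>i sin t\<close> in the
  binomial expansion are imaginary.\<close>
lemma cos_double_arg_expansion:
  fixes t :: real
  shows "cos (2 * real n * t) =
    (\<Sum>s\<le>n. real ((2 * n) choose (2 * s)) * (- (sin t)\<^sup>2) ^ s * ((cos t)\<^sup>2) ^ (n - s))"
proof -
  let ?f = "\<lambda>k. of_nat ((2 * n) choose k) * (\<i> * of_real (sin t)) ^ k * of_real (cos t) ^ (2 * n - k)"
  have "cos (2 * real n * t) = Re ((\<i> * of_real (sin t) + of_real (cos t)) ^ (2 * n))"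
  proof -
    have "\<i> * of_real (sin t) + of_real (cos t) = cis t" by (simp add: complex_eq_iff)
    then show ?thesis by (simp only: Complex.DeMoivre cis.sel of_nat_mult of_nat_numeral)
  qed
  also have "\<dots> = Re (\<Sum>k\<le>2 * n. ?f k)"
    by (simp only: binomial_ring)
  also have "\<dots> = (\<Sum>k\<le>2 * n. Re (?f k))" by (rule Re_sum)
  also have "\<dots> = (\<Sum>k\<in>(\<lambda>s. 2 * s) ` {..n}. Re (?f k))"
  proof (rule sum.mono_neutral_right)
    show "\<forall>i\<in>{..2 * n} - (\<lambda>s. 2 * s) ` {..n}. Re (?f i) = 0"
    proof
      fix i assume i: "i \<in> {..2 * n} - (\<lambda>s. 2 * s) ` {..n}"
      have "odd i"
      proof
        assume "even i"
        then obtain s where "i = 2 * s" by (elim evenE)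
        with i show False by auto
      qed
      then obtain s where "i = 2 * s + 1" by (elim oddE)
      then have "(\<i> * complex_of_real (sin t)) ^ i = \<i> * of_real (sin t * (- (sin t)\<^sup>2) ^ s)"
        by (simp add: power_mult power_mult_distrib)
      moreover have "complex_of_real (cos t) ^ (2 * n - i) = of_real (cos t ^ (2 * n - i))"
        by simp
      ultimately have "?f i = \<i> * of_real (real ((2 * n) choose i) * (sin t * (- (sin t)\<^sup>2) ^ s) * cos t ^ (2 * n - i))"
        by (simp only: of_real_mult of_real_of_nat_eq mult_ac)
      then show "Re (?f i) = 0"
        by (simp only: Re_i_times Im_complex_of_real minus_zero)
    qed
  qed auto
  also have "\<dots> = (\<Sum>s\<le>n. Re (?f (2 * s)))"
    by (subst sum.reindex) (auto simp: inj_on_def)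
  also have "\<dots> = (\<Sum>s\<le>n. real ((2 * n) choose (2 * s)) * (- (sin t)\<^sup>2) ^ s * ((cos t)\<^sup>2) ^ (n - s))"
  proof (rule sum.cong)
    fix s
    have "(\<i> * complex_of_real (sin t)) ^ (2 * s) = of_real ((- (sin t)\<^sup>2) ^ s)"
      by (simp add: power_mult power_mult_distrib)
    moreover have "complex_of_real (cos t) ^ (2 * n - 2 * s) = of_real (((cos t)\<^sup>2) ^ (n - s))"
      by (simp add: power_mult[symmetric] diff_mult_distrib2)
    ultimately have "?f (2 * s) = of_real (real ((2 * n) choose (2 * s)) * (- (sin t)\<^sup>2) ^ s * ((cos t)\<^sup>2) ^ (n - s))"
      by (simp only: of_real_mult of_real_of_nat_eq)
    then show "Re (?f (2 * s)) = real ((2 * n) choose (2 * s)) * (- (sin t)\<^sup>2) ^ s * ((cos t)\<^sup>2) ^ (n - s)"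
      by (simp only: Re_complex_of_real)
  qed simp
  finally show ?thesis .
qed

text \<open>The half-angle formulas make \<open>(x - 1)/2\<close> and \<open>(x + 1)/2\<close> equal to \<open>-sin\<^sup>2 (t/2)\<close> and \<open>cos\<^sup>2 (t/2)\<close>,
  and the defining sum becomes the expansion above at \<open>t/2\<close>.\<close>
lemma jacobi_P_cos:
  "jacobi_P (- 1 / 2) (- 1 / 2) n (cos t) = cheb_coeff n * cos (real n * t)"
proof -
  have s: "(cos t - 1) / 2 = - (sin (t / 2))\<^sup>2" and c: "(cos t + 1) / 2 = (cos (t / 2))\<^sup>2"
    using cos_double_sin[of "t / 2"] cos_double_cos[of "t / 2"] by simp_all
  have "jacobi_P (- 1 / 2) (- 1 / 2) n (cos t) = (\<Sum>s\<le>n. ((real n - 1/2) gchoose (n - s)) * ((real n - 1/2) gchoose s) *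
        (- (sin (t / 2))\<^sup>2) ^ s * ((cos (t / 2))\<^sup>2) ^ (n - s))"
    by (simp add: jacobi_P_def s c)
  also have "\<dots> = (\<Sum>s\<le>n. cheb_coeff n * (real ((2 * n) choose (2 * s)) *
        (- (sin (t / 2))\<^sup>2) ^ s * ((cos (t / 2))\<^sup>2) ^ (n - s)))"
    by (rule sum.cong) (simp_all add: gbinomial_half_mult)
  also have "\<dots> = cheb_coeff n * cos (2 * real n * (t / 2))"
    by (simp only: cos_double_arg_expansion sum_distrib_left)
  finally show ?thesis by simp
qed

section \<open>Discrete orthogonality of the cosines\<close>

text \<open>The nodes are the odd multiples of \<open>\<pi>/(2N)\<close>. With \<open>a = m \<pi>/(2N)\<close>, multiplication by
  \<open>2 sin a\<close> makes the sum telescope to \<open>sin (m \<pi>) = 0\<close>, and \<open>0 < m\<close> together with \<open>m < 2N\<close> keeps the multiplier nonzero.\<close>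
lemma sum_cos_odd_multiples:
  assumes "0 < m" "m < 2 * N"
  shows "(\<Sum>i<N. cos (real m * cheb_node N (Suc i))) = 0"
proof -
  define a where "a = real m * pi / (2 * real N)"
  have "0 < a" "a < pi"
    using assms by (auto simp: a_def field_simps)
  then have "sin a \<noteq> 0" using sin_gt_zero[of a] by simp
  have "2 * sin a * cos (real m * cheb_node N (Suc i)) = sin (2 * real (Suc i) * a) - sin (2 * real i * a)" for i
  proof -
    have "real m * cheb_node N (Suc i) = (2 * real i + 1) * a"
      by (simp add: cheb_node_def a_def field_simps)
    then show ?thesis
      using sin_add[of "(2 * real i + 1) * a" a] sin_diff[of "(2 * real i + 1) * a" a]
      by (simp add: algebra_simps)
  qed
  then have "2 * sin a * (\<Sum>i<N. cos (real m * cheb_node N (Suc i))) = (\<Sum>i<N. sin (2 * real (Suc i) * a) - sin (2 * real i * a))"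
    by (simp add: sum_distrib_left)
  also have "\<dots> = sin (2 * real N * a)"
    by (subst sum_lessThan_telescope) simp
  also have "2 * real N * a = real m * pi" using assms by (simp add: a_def)
  finally show ?thesis using \<open>sin a \<noteq> 0\<close> by simp
qed

text \<open>The product formula for cosines reduces this to sums with the frequencies \<open>\<bar>j - k\<bar>\<close> and \<open>j + k\<close>, both
  below \<open>2N\<close>; such a sum vanishes unless its frequency is \<open>0\<close>. For \<open>j = k = 0\<close> both are \<open>0\<close>, for
  \<open>j = k > 0\<close> only the first.\<close>
lemma cos_node_orthogonal:
  assumes "j < N" "k < N"
  shows "(\<Sum>i<N. cos (real j * cheb_node N (Suc i)) * cos (real k * cheb_node N (Suc i))) =
     (if j \<noteq> k then 0 else if k = 0 then real N else real N / 2)"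
proof -
  have *: "(\<Sum>i<N. cos (real j * cheb_node N (Suc i)) * cos (real k * cheb_node N (Suc i))) =
    ((\<Sum>i<N. cos (real (j - k) * cheb_node N (Suc i))) + (\<Sum>i<N. cos (real (j + k) * cheb_node N (Suc i)))) / 2"
    if "k \<le> j" for j k
    using that by (simp add: cos_times_cos sum_divide_distrib of_nat_diff sum.distrib add_divide_distrib algebra_simps)
  have **: "(\<Sum>i<N. cos (real m * cheb_node N (Suc i))) = (if m = 0 then real N else 0)" if "m < 2 * N" for m
    using that sum_cos_odd_multiples[of m N] by auto
  have le: "(\<Sum>i<N. cos (real j * cheb_node N (Suc i)) * cos (real k * cheb_node N (Suc i))) =
     (if j \<noteq> k then 0 else if k = 0 then real N else real N / 2)" if "k \<le> j" "j < N" for j k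
    unfolding *[OF that(1)] using that **[of "j - k"] **[of "j + k"]
    by (auto simp del: of_nat_add of_nat_diff)
  show ?thesis
  proof (cases "k \<le> j")
    case True
    then show ?thesis using le assms(1) by blast
  next
    case False
    then show ?thesis using le[of j k] assms(2) by (simp add: mult.commute)
  qed
qed

section \<open>Weighted cell averages\<close>

text \<open>The change of variables \<open>x = cos t\<close>, carried out on antiderivatives: \<open>- G (arccos x)\<close> is an
  antiderivative of the integrand because the derivative of \<open>arccos\<close> is minus the weight. The strict
  bounds on \<open>a\<close> and \<open>b\<close> keep the interval away from \<open>\<plusminus>1\<close>, where \<open>arccos\<close> is not differentiable.\<close>
lemma integral_cheb_weight_cos:
  fixes g G :: "real \<Rightarrow> real"
  assumes ab: "0 < a" "a \<le> b" "b < pi"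
    and G: "\<And>t. (G has_real_derivative g t) (at t)"
    and f: "\<And>t. f (cos t) = g t"
  shows "integral {cos b..cos a} (\<lambda>x. f x * cheb_weight x) = G b - G a"
proof -
  have "((\<lambda>x. f x * cheb_weight x) has_integral (- G (arccos (cos a)) - - G (arccos (cos b)))) {cos b..cos a}"
  proof (rule fundamental_theorem_of_calculus)
    show "cos b \<le> cos a" using ab by (simp add: cos_monotone_0_pi_le)
    fix x assume x: "x \<in> {cos b..cos a}"
    have "cos pi < cos b" "cos a < cos 0" using ab by (intro cos_monotone_0_pi; simp)+
    then have x1: "-1 < x" "x < 1" using x by auto
    have "((\<lambda>x. - G (arccos x)) has_real_derivative - (g (arccos x) * inverse (- sqrt (1 - x\<^sup>2)))) (at x)"
      by (rule DERIV_minus DERIV_chain2 G DERIV_arccos x1)+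
    moreover have "g (arccos x) = f x" using f[of "arccos x"] x1 by simp
    ultimately show "((\<lambda>x. - G (arccos x)) has_vector_derivative f x * cheb_weight x) (at x within {cos b..cos a})"
      by (simp add: cheb_weight_def has_real_derivative_iff_has_vector_derivative[symmetric] field_simps has_field_derivative_at_within)
  qed
  then show ?thesis using ab by (simp add: integral_unique arccos_cos)
qed

lemma cell_angle_bounds:
  assumes "i < N" "0 < \<rho>" "\<rho> < pi / (2 * real N)"
  shows "0 < cheb_node N (Suc i) - \<rho>" "cheb_node N (Suc i) + \<rho> < pi"
proof -
  define h where "h = pi / (2 * real N)"
  have h: "0 < h" "2 * real N * h = pi" using assms(1) by (simp_all add: h_def)
  have node: "cheb_node N (Suc i) = (2 * real i + 1) * h"
    by (simp add: cheb_node_def h_def algebra_simps add_divide_distrib)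
  have "1 * h \<le> (2 * real i + 1) * h" "(2 * real i + 1) * h \<le> (2 * real N - 1) * h"
    using h(1) assms(1) by (intro mult_right_mono; simp)+
  then show "0 < cheb_node N (Suc i) - \<rho>" "cheb_node N (Suc i) + \<rho> < pi"
    using assms(3) h(2) unfolding node h_def[symmetric] by (simp_all add: left_diff_distrib)
qed

text \<open>The diagonal entries of \<open>D\<close>. For \<open>k = 0\<close> the quotient \<open>sin 0 / 0\<close> would be \<open>0\<close> instead of its
  limit \<open>1\<close>, hence the case distinction.\<close>
definition col_scale :: "real \<Rightarrow> nat \<Rightarrow> real" where
  "col_scale \<rho> k = (if k = 0 then 1 else cheb_coeff k * (sin (real k * \<rho>) / (real k * \<rho>)))"

lemma hist_mat_entry:
  assumes "i < N" "k < N" and \<rho>: "0 < \<rho>" "\<rho> < pi / (2 * real N)"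
  shows "hist_mat N \<rho> $$ (i, k) = col_scale \<rho> k * cos (real k * cheb_node N (Suc i))"
proof -
  let ?\<tau> = "cheb_node N (Suc i)"
  note b = cell_angle_bounds[OF assms(1) \<rho>]
  have int: "integral (cheb_cell N \<rho> (Suc i)) (\<lambda>x. f x * cheb_weight x) = G (?\<tau> + \<rho>) - G (?\<tau> - \<rho>)"
    if "\<And>t. (G has_real_derivative g t) (at t)" "\<And>t. f (cos t) = g t" for f g G :: "real \<Rightarrow> real"
    unfolding cheb_cell_def by (rule integral_cheb_weight_cos) (use that b \<rho> in auto)
  have w: "integral (cheb_cell N \<rho> (Suc i)) cheb_weight = 2 * \<rho>"
    using int[of "\<lambda>t. t" "\<lambda>_. 1" "\<lambda>_. 1"] by simp
  have "integral (cheb_cell N \<rho> (Suc i)) (\<lambda>x. jacobi_P (- 1 / 2) (- 1 / 2) k x * cheb_weight x) =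
     2 * \<rho> * (col_scale \<rho> k * cos (real k * ?\<tau>))"
  proof (cases "k = 0")
    case True
    have "jacobi_P (- 1 / 2) (- 1 / 2) 0 x = 1" for x by (simp add: jacobi_P_def)
    then show ?thesis using True w by (simp add: col_scale_def)
  next
    case False
    have "integral (cheb_cell N \<rho> (Suc i)) (\<lambda>x. jacobi_P (- 1 / 2) (- 1 / 2) k x * cheb_weight x) =
      cheb_coeff k * sin (real k * (?\<tau> + \<rho>)) / real k - cheb_coeff k * sin (real k * (?\<tau> - \<rho>)) / real k"
      using False
      by (intro int[where g = "\<lambda>t. cheb_coeff k * cos (real k * t)"] jacobi_P_cos)
         (auto intro!: derivative_eq_intros)
    also have "\<dots> = cheb_coeff k * (2 * cos (real k * ?\<tau>) * sin (real k * \<rho>)) / real k"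
      by (simp add: distrib_left right_diff_distrib sin_add sin_diff diff_divide_distrib[symmetric])
    finally show ?thesis using False \<rho> by (simp add: col_scale_def field_simps)
  qed
  then show ?thesis using assms(1,2) \<rho> w by (simp add: hist_mat_def)
qed

section \<open>The singular values\<close>

definition sing_val :: "nat \<Rightarrow> real \<Rightarrow> nat \<Rightarrow> real" where
  "sing_val N \<rho> k = col_scale \<rho> k * sqrt (if k = 0 then real N else real N / 2)"

lemma sing_val_eq:
  "sing_val N \<rho> k = (if k = 0 then sqrt (real N)
     else sqrt (real N / 2) * cheb_coeff k * (sin (real k * \<rho>) / (real k * \<rho>)))"
  by (simp add: sing_val_def col_scale_def)

lemma gram_hist_mat:
  assumes \<rho>: "0 < \<rho>" "\<rho> < pi / (2 * real N)"
  shows "transpose_mat (hist_mat N \<rho>) * hist_mat N \<rho> =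
    Matrix.mat N N (\<lambda>(j, k). if j = k then (sing_val N \<rho> k)\<^sup>2 else 0)"
proof (rule eq_matI)
  fix j k assume "j < dim_row (Matrix.mat N N (\<lambda>(j, k). if j = k then (sing_val N \<rho> k)\<^sup>2 else 0))"
    "k < dim_col (Matrix.mat N N (\<lambda>(j, k). if j = k then (sing_val N \<rho> k)\<^sup>2 else 0))"
  then have jk: "j < N" "k < N" by auto
  have sq: "(sing_val N \<rho> k)\<^sup>2 = (col_scale \<rho> k)\<^sup>2 * (if k = 0 then real N else real N / 2)"
    by (simp add: sing_val_def power_mult_distrib)
  have dim: "dim_row (hist_mat N \<rho>) = N" "dim_col (hist_mat N \<rho>) = N" by (simp_all add: hist_mat_def)
  have "(transpose_mat (hist_mat N \<rho>) * hist_mat N \<rho>) $$ (j, k) =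
     (\<Sum>i<N. hist_mat N \<rho> $$ (i, j) * hist_mat N \<rho> $$ (i, k))"
    using jk dim by (simp add: scalar_prod_def atLeast0LessThan)
  also have "\<dots> = (\<Sum>i<N. (col_scale \<rho> j * col_scale \<rho> k) * (cos (real j * cheb_node N (Suc i)) * cos (real k * cheb_node N (Suc i))))"
    using jk by (intro sum.cong) (simp_all add: hist_mat_entry[OF _ _ \<rho>])
  also have "\<dots> = (if j = k then (sing_val N \<rho> k)\<^sup>2 else 0)"
    unfolding sum_distrib_left[symmetric] cos_node_orthogonal[OF jk]
    by (simp add: sq power2_eq_square[of "col_scale \<rho> k", symmetric])
  finally show "(transpose_mat (hist_mat N \<rho>) * hist_mat N \<rho>) $$ (j, k) =
    Matrix.mat N N (\<lambda>(j, k). if j = k then (sing_val N \<rho> k)\<^sup>2 else 0) $$ (j, k)"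
    using jk by simp
qed (simp_all add: hist_mat_def)

lemma proots_prod_list_linear:
  "proots (\<Prod>a\<leftarrow>as. [:- a, 1:]) = mset (as :: real list)"
proof (induction as)
  case (Cons a as)
  have "(\<Prod>a\<leftarrow>as. [:- a, 1:]) \<noteq> (0 :: real poly)"
    by (auto simp: prod_list_zero_iff)
  then show ?case using Cons by (simp add: proots_mult del: mult_pCons_left)
qed simp

text \<open>The characteristic polynomial of a diagonal matrix is the product of the linear factors of its
  diagonal entries; nonnegativity of \<open>s\<close> lets the square root undo the square.\<close>
lemma singular_values_of_diagonal_gram:
  assumes A: "transpose_mat A * A = Matrix.mat n n (\<lambda>(j, k). if j = k then (s k)\<^sup>2 else 0)"
    and s: "\<And>k. k < n \<Longrightarrow> s k \<ge> 0"
  shows "singular_values A = image_mset s (mset_set {..<n})"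
proof -
  let ?D = "Matrix.mat n n (\<lambda>(j, k). if j = k then (s k)\<^sup>2 else 0)"
  have "char_poly ?D = (\<Prod>a\<leftarrow>diag_mat ?D. [:- a, 1:])"
    by (rule char_poly_upper_triangular[of _ n]) auto
  moreover have "diag_mat ?D = map (\<lambda>k. (s k)\<^sup>2) [0..<n]"
    by (simp add: diag_mat_def)
  ultimately have "proots (char_poly ?D) = mset (map (\<lambda>k. (s k)\<^sup>2) [0..<n])"
    by (simp only: proots_prod_list_linear)
  then have "singular_values A = image_mset (\<lambda>k. sqrt ((s k)\<^sup>2)) (mset_set {..<n})"
    by (simp add: singular_values_def A multiset.map_comp comp_def atLeast0LessThan)
  also have "\<dots> = image_mset s (mset_set {..<n})"
    using s by (intro image_mset_cong) auto
  finally show ?thesis .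
qed

section \<open>Monotonicity and the extreme singular values\<close>

text \<open>The derivative has the sign of \<open>t cos t - sin t\<close>, which vanishes at \<open>0\<close> and has the derivative
  \<open>- t sin t\<close>.\<close>
lemma sinc_strict_antimono:
  fixes x y :: real
  assumes "0 < x" "x < y" "y < pi"
  shows "sin y / y < sin x / x"
proof -
  have tc: "t * cos t < sin t" if "0 < t" "t < pi" for t :: real
  proof -
    have "(\<lambda>t::real. sin t - t * cos t) 0 < (\<lambda>t. sin t - t * cos t) t"
    proof (rule DERIV_pos_imp_increasing_open[where f = "\<lambda>t::real. sin t - t * cos t"])
      fix u :: real assume u: "0 < u" "u < t"
      have "((\<lambda>t. sin t - t * cos t) has_real_derivative u * sin u) (at u)"
        by (auto intro!: derivative_eq_intros)
      moreover have "u * sin u > 0" using u that by (simp add: sin_gt_zero)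
      ultimately show "\<exists>y. ((\<lambda>t. sin t - t * cos t) has_real_derivative y) (at u) \<and> 0 < y" by blast
    qed (use that in \<open>auto intro!: continuous_intros\<close>)
    then show ?thesis by simp
  qed
  have "(\<lambda>t. sin t / t) y < (\<lambda>t. sin t / t) x"
  proof (rule DERIV_neg_imp_decreasing[where f = "\<lambda>t::real. sin t / t", OF \<open>x < y\<close>])
    fix t assume t: "x \<le> t" "t \<le> y"
    then have t0: "0 < t" "t < pi" using assms by auto
    have "((\<lambda>t. sin t / t) has_real_derivative (t * cos t - sin t) / t\<^sup>2) (at t)"
      using t0 by (auto intro!: derivative_eq_intros simp: power2_eq_square field_simps)
    moreover have "(t * cos t - sin t) / t\<^sup>2 < 0" using tc[OF t0] t0 by (simp add: divide_neg_pos)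
    ultimately show "\<exists>z. ((\<lambda>t. sin t / t) has_real_derivative z) (at t) \<and> z < 0" by blast
  qed
  then show ?thesis by simp
qed

lemma cheb_coeff_pos: "cheb_coeff k > 0"
  by (simp add: cheb_coeff_def pochhammer_pos)

text \<open>Consecutive coefficients have the ratio \<open>(n + 1/2) / (n + 1)\<close>.\<close>
lemma cheb_coeff_antimono: "j \<le> k \<Longrightarrow> cheb_coeff k \<le> cheb_coeff j"
proof (induction rule: dec_induct)
  case (step n)
  have "cheb_coeff (Suc n) = cheb_coeff n * ((1 / 2 + real n) / (1 + real n))"
    by (simp add: cheb_coeff_def pochhammer_Suc field_simps)
  also have "\<dots> \<le> cheb_coeff n * 1"
    by (intro mult_left_mono less_imp_le[OF cheb_coeff_pos]) (simp add: field_simps)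
  finally show ?case using step by simp
qed simp

lemma index_mult_less_pi:
  assumes "k < N" "0 < \<rho>" "\<rho> < pi / (2 * real N)"
  shows "real k * \<rho> < pi"
proof -
  have "real k * \<rho> \<le> real N * \<rho>" using assms by (intro mult_right_mono) auto
  also have "\<dots> < real N * (pi / (2 * real N))" using assms by (intro mult_strict_left_mono) auto
  also have "\<dots> \<le> pi" using assms by simp
  finally show ?thesis .
qed

lemma sing_val_pos:
  assumes "k < N" "0 < \<rho>" "\<rho> < pi / (2 * real N)"
  shows "sing_val N \<rho> k > 0"
  using assms index_mult_less_pi[OF assms] by (auto simp: sing_val_eq cheb_coeff_pos sin_gt_zero)

text \<open>From \<open>k = 1\<close> on, both factors decrease. The step from \<open>k = 0\<close> is separate, since the first singular
  value lacks the factor \<open>1/\<surd>2\<close>; it is an upper bound because \<open>a\<^sub>k\<close> and \<open>sin x / x\<close> are at most \<open>1\<close>.\<close>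
lemma sing_val_antimono:
  assumes "j \<le> k" "k < N" and \<rho>: "0 < \<rho>" "\<rho> < pi / (2 * real N)"
  shows "sing_val N \<rho> k \<le> sing_val N \<rho> j"
proof (cases "j = 0")
  case True
  show ?thesis
  proof (cases "k = 0")
    case False
    have "sin (real k * \<rho>) / (real k * \<rho>) \<le> 1" "sin (real k * \<rho>) / (real k * \<rho>) > 0"
      using False \<rho> index_mult_less_pi[OF assms(2) \<rho>] by (auto simp: sin_x_le_x sin_gt_zero)
    moreover have "cheb_coeff k \<le> 1"
      using cheb_coeff_antimono[of 0 k] by (simp add: cheb_coeff_def)
    ultimately have "sqrt (real N / 2) * cheb_coeff k * (sin (real k * \<rho>) / (real k * \<rho>)) \<le> sqrt (real N) * 1 * 1"
      by (intro mult_mono) (auto simp: cheb_coeff_pos less_imp_le)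
    then show ?thesis using True False by (simp add: sing_val_eq)
  qed (simp add: True)
next
  case False
  have "sin (real k * \<rho>) / (real k * \<rho>) \<le> sin (real j * \<rho>) / (real j * \<rho>)"
  proof (cases "j = k")
    case neq: False
    show ?thesis
      by (rule less_imp_le, rule sinc_strict_antimono)
         (use neq False assms index_mult_less_pi[OF assms(2) \<rho>] in auto)
  qed simp
  moreover have "0 \<le> sin (real k * \<rho>) / (real k * \<rho>)"
    using index_mult_less_pi[OF assms(2) \<rho>] \<rho> by (auto intro!: divide_nonneg_nonneg sin_ge_zero)
  ultimately have "sqrt (real N / 2) * cheb_coeff k * (sin (real k * \<rho>) / (real k * \<rho>))
      \<le> sqrt (real N / 2) * cheb_coeff j * (sin (real j * \<rho>) / (real j * \<rho>))"
    using assms(1) by (intro mult_mono mult_nonneg_nonneg cheb_coeff_antimono) (auto simp: cheb_coeff_pos less_imp_le)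
  then show ?thesis using False assms by (auto simp: sing_val_eq)
qed

lemma singular_values_hist_mat:
  assumes "0 < \<rho>" "\<rho> < pi / (2 * real N)"
  shows "singular_values (hist_mat N \<rho>) = image_mset (sing_val N \<rho>) (mset_set {..<N})"
  using gram_hist_mat[OF assms] sing_val_pos[OF _ assms]
  by (intro singular_values_of_diagonal_gram) (auto simp: less_imp_le)

lemma sigma_max_hist_mat:
  assumes "N > 0" "0 < \<rho>" "\<rho> < pi / (2 * real N)"
  shows "sigma_max (hist_mat N \<rho>) = sing_val N \<rho> 0"
  unfolding sigma_max_def singular_values_hist_mat[OF assms(2,3)]
  using assms by (intro Max_eqI) (auto intro: sing_val_antimono)

lemma sigma_min_hist_mat:
  assumes "N > 0" "0 < \<rho>" "\<rho> < pi / (2 * real N)"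
  shows "sigma_min (hist_mat N \<rho>) = sing_val N \<rho> (N - 1)"
  unfolding sigma_min_def singular_values_hist_mat[OF assms(2,3)]
  using assms by (intro Min_eqI) (auto intro!: sing_val_antimono)

section \<open>The condition number\<close>

lemma cond2_hist_mat:
  assumes "N \<ge> 2" "0 < \<rho>" "\<rho> < pi / (2 * real N)"
  shows "cond2 (hist_mat N \<rho>) =
          sqrt 2 / cheb_coeff (N - 1) * ((real (N - 1) * \<rho>) / sin (real (N - 1) * \<rho>))"
proof -
  have "sqrt (real N) = sqrt 2 * sqrt (real N / 2)" by (simp flip: real_sqrt_mult)
  then show ?thesis
    using assms by (simp add: cond2_def sigma_max_hist_mat sigma_min_hist_mat sing_val_eq)
qed

lemma INF_eq_limit_at_right:
  fixes f :: "real \<Rightarrow> real"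
  assumes "a < b" and mono: "strict_mono_on {a<..<b} f" and lim: "(f \<longlongrightarrow> L) (at_right a)"
  shows "(INF x\<in>{a<..<b}. f x) = L"
proof (rule cInf_eq_non_empty)
  show "f ` {a<..<b} \<noteq> {}" using assms by simp
  fix y assume "y \<in> f ` {a<..<b}"
  then obtain x where x: "x \<in> {a<..<b}" and y: "y = f x" by blast
  have "eventually (\<lambda>y. f y \<le> f x) (at_right a)"
    unfolding eventually_at_right_field using x
    by (intro exI[of _ x]) (auto intro!: less_imp_le[OF strict_mono_onD[OF mono]])
  then show "L \<le> y" unfolding y by (rule tendsto_upperbound[OF lim]) simp
next
  fix B assume B: "\<And>y. y \<in> f ` {a<..<b} \<Longrightarrow> B \<le> y"
  have "eventually (\<lambda>y. B \<le> f y) (at_right a)"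
    unfolding eventually_at_right_field using B \<open>a < b\<close> by (intro exI[of _ b]) auto
  then show "B \<le> L" by (rule tendsto_lowerbound[OF lim]) simp
qed

theorem mainTheorem7:
  fixes N :: nat
  assumes "N \<ge> 2"
  shows
    "(\<forall>\<rho>. 0 < \<rho> \<and> \<rho> < pi / (2 * real N) \<longrightarrow>
        singular_values (hist_mat N \<rho>) =
          add_mset (sqrt (real N))
            (image_mset
              (\<lambda>k. sqrt (real N / 2) * cheb_coeff k * (sin (real k * \<rho>) / (real k * \<rho>)))
              (mset_set {1..N - 1})) \<and>
        sigma_max (hist_mat N \<rho>) = sqrt (real N) \<and>
        sigma_min (hist_mat N \<rho>) =
          sqrt (real N / 2) * cheb_coeff (N - 1) *
            (sin (real (N - 1) * \<rho>) / (real (N - 1) * \<rho>)) \<and>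
        cond2 (hist_mat N \<rho>) =
          sqrt 2 / cheb_coeff (N - 1) *
            ((real (N - 1) * \<rho>) / sin (real (N - 1) * \<rho>))) \<and>
     strict_mono_on {0<..<pi / (2 * real N)} (\<lambda>\<rho>. cond2 (hist_mat N \<rho>)) \<and>
     (INF \<rho>\<in>{0<..<pi / (2 * real N)}. cond2 (hist_mat N \<rho>)) = sqrt 2 / cheb_coeff (N - 1) \<and>
     ((\<lambda>\<rho>. cond2 (hist_mat N \<rho>)) \<longlongrightarrow> sqrt 2 / cheb_coeff (N - 1)) (at_right 0)"
proof -
  let ?R = "pi / (2 * real N)" and ?n = "real (N - 1)" and ?C = "sqrt 2 / cheb_coeff (N - 1)"
  let ?\<kappa> = "\<lambda>\<rho>. cond2 (hist_mat N \<rho>)"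
  have n: "?n > 0" "N > 0" using assms by auto
  have R: "?R > 0" using assms by simp
  have C: "?C > 0" by (simp add: cheb_coeff_pos)
  note cond = cond2_hist_mat[OF assms]
  have spectrum: "singular_values (hist_mat N \<rho>) =
          add_mset (sqrt (real N))
            (image_mset
              (\<lambda>k. sqrt (real N / 2) * cheb_coeff k * (sin (real k * \<rho>) / (real k * \<rho>)))
              (mset_set {1..N - 1}))" if \<rho>: "0 < \<rho>" "\<rho> < ?R" for \<rho>
  proof -
    have "{..<N} = insert 0 {1..N - 1}" using n by auto
    then have "mset_set {..<N} = add_mset 0 (mset_set {1..N - 1})" by simp
    moreover have "image_mset (sing_val N \<rho>) (mset_set {1..N - 1}) = image_mset
        (\<lambda>k. sqrt (real N / 2) * cheb_coeff k * (sin (real k * \<rho>) / (real k * \<rho>))) (mset_set {1..N - 1})"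
      by (intro image_mset_cong) (auto simp: sing_val_eq)
    ultimately show ?thesis
      by (simp add: singular_values_hist_mat[OF \<rho>] sing_val_eq[of N \<rho> 0])
  qed
  have mono: "strict_mono_on {0<..<?R} ?\<kappa>"
  proof (rule strict_mono_onI)
    fix r s assume "r \<in> {0<..<?R}" "s \<in> {0<..<?R}" and rs: "r < s"
    then have r: "0 < r" "r < ?R" and s: "0 < s" "s < ?R" by auto
    have bd: "?n * s < pi" using index_mult_less_pi[of "N - 1" N s] s n by simp
    have "sin (?n * s) / (?n * s) < sin (?n * r) / (?n * r)"
      by (rule sinc_strict_antimono) (use r rs n bd in auto)
    moreover have "0 < sin (?n * s) / (?n * s)"
      using s n bd by (intro divide_pos_pos sin_gt_zero mult_pos_pos) auto
    ultimately have "inverse (sin (?n * r) / (?n * r)) < inverse (sin (?n * s) / (?n * s))"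
      by (rule less_imp_inverse_less)
    then have "(?n * r) / sin (?n * r) < (?n * s) / sin (?n * s)"
      by (simp only: inverse_divide)
    then show "?\<kappa> r < ?\<kappa> s"
      unfolding cond[OF r] cond[OF s] by (rule mult_strict_left_mono[OF _ C])
  qed
  have lim: "(?\<kappa> \<longlongrightarrow> ?C) (at_right 0)"
  proof -
    have "((\<lambda>\<rho>. (?n * \<rho>) / sin (?n * \<rho>)) \<longlongrightarrow> 1) (at_right 0)"
      using n(1) by real_asymp
    then have "((\<lambda>\<rho>. ?C * ((?n * \<rho>) / sin (?n * \<rho>))) \<longlongrightarrow> ?C * 1) (at_right 0)"
      by (rule tendsto_mult_left)
    moreover have "eventually (\<lambda>\<rho>. ?C * ((?n * \<rho>) / sin (?n * \<rho>)) = ?\<kappa> \<rho>) (at_right 0)"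
      unfolding eventually_at_right_field using R cond by (intro exI[of _ ?R]) auto
    ultimately show ?thesis by (simp add: filterlim_cong tendsto_cong)
  qed
  have extremes: "sigma_max (hist_mat N \<rho>) = sqrt (real N)" "sigma_min (hist_mat N \<rho>) =
          sqrt (real N / 2) * cheb_coeff (N - 1) *
            (sin (real (N - 1) * \<rho>) / (real (N - 1) * \<rho>))"
    if \<rho>: "0 < \<rho>" "\<rho> < ?R" for \<rho>
    using sigma_max_hist_mat[OF n(2) \<rho>] sigma_min_hist_mat[OF n(2) \<rho>] assms by (simp_all add: sing_val_eq)
  show ?thesis
    using spectrum extremes cond mono lim INF_eq_limit_at_right[OF R mono lim] by blast
qed
end
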